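(* Let $G=(V,E)$ be a finite connected loopless graph with edge lengths $\ell:E\to\mathbb{Z}_{>0}$, and let $H$ be the graph obtained from $G$ by subdividing each edge $e$ exactly $\ell_e-1$ times (notation as in the context). Let $D\in\operatorname{Div}(H)$ be a divisor whose support is contained in $V(G)\subseteq V(H)$. Then: (i) for every $f\colon V(G)\to\mathbb{Z}$, the divisor $D+\operatorname{div}_\ell(f)$ is $G$-admissible and linearly equivalent to $D$ on $H$; (ii) every $G$-admissible divisor $D'$ on $H$ linearly equivalent to $D$ is of the form $D+\operatorname{div}_\ell(f)$ for some $f\colon V(G)\to\mathbb{Z}$.
   Context: $G=(V,E)$ is a finite connected graph without loops (multiple edges allowed). Each edge $\{u,v\}$ gives two oriented edges $uv$ (tail $u$, head $v$) and $vu$; $\mathbb{E}$ is the set of oriented edges and $\bar e$ the reverse of $e$. The length function $\ell$ is extended to $\mathbb{E}$ by $\ell_{\bar e}=\ell_e$. $H$ is obtained by replacing each oriented edge $e=uv$ by a path $u\,x^e_1\,x^e_2\cdots x^e_{\ell_e-1}\,v$ with new vertices, where $x^e_0:=u$, $x^e_{\ell_e}:=v$ and $x^e_i=x^{\bar e}_{\ell_e-i}$. $\operatorname{Div}(H)$ is the free abelian group on $V(H)$; for $F\colon V(H)\to\mathbb{Z}$, $\operatorname{div}(F)(w)=\sum (F(w')-F(w))$, the sum over the edges of $H$ incident to $w$ with $w'$ the other endpoint; divisors differing by some $\operatorname{div}(F)$ are linearly equivalent. A divisor $D$ on $H$ is $G$-admissible if for each oriented edge $e$ of $G$, the values $D(x^e_j)$,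 $j=1,\dots,\ell_e-1$, are all $0$ except for at most one $j$, where the value is $1$. For $f\colon V(G)\to\mathbb{Z}$ and $e=uv\in\mathbb{E}$, set $\delta_e(f)=\lfloor (f(v)-f(u))/\ell_e\rfloor$. The divisor $\operatorname{div}_\ell(f)$ on $H$ is defined by: $\operatorname{div}_\ell(f)(u)=\sum_{e\in\mathbb{E},\ \text{tail}(e)=u}\delta_e(f)$ for $u\in V(G)$; for each oriented edge $e=uv$ with $\ell_e\nmid f(v)-f(u)$, $\operatorname{div}_\ell(f)(x^{\bar e}_{r_e})=1$ where $r_e\in\{1,\dots,\ell_e-1\}$ is the remainder of $f(v)-f(u)$ modulo $\ell_e$; and $0$ at all other vertices of $H$. *)

theory Defs
  imports "Graph_Theory.Graph_Theory"
begin

text \<open>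
  A multigraph is given by its oriented edges: a \<open>bidirected_digraph G arev\<close>, where the arcs are
  the oriented edges and \<open>arev\<close> is orientation reversal. An unoriented edge is a pair
  \<open>{e, arev e}\<close>, so a length function on edges is an \<open>arev\<close>-invariant function on arcs.
\<close>

datatype ('v, 'e) subdiv_vert = Orig 'v | Mid "('e \<times> nat) set"

text \<open>
  The vertex \<open>x\<^sup>e\<^sub>i\<close>, \<open>0 \<le> i \<le> len e\<close>. An interior vertex carries both of its names, one for each
  orientation of the edge, which realises \<open>x\<^sup>e\<^sub>i = x\<^bsup>arev e\<^esup>\<^bsub>len e - i\<^esub>\<close>.
\<close>

definition subdiv_pt ::
  "('v, 'e) pre_digraph \<Rightarrow> ('e \<Rightarrow> 'e) \<Rightarrow> ('e \<Rightarrow> nat) \<Rightarrow> 'e \<Rightarrow> nat \<Rightarrow> ('v, 'e) subdiv_vert" where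
  "subdiv_pt G arev len e i =
     (if i = 0 then Orig (tail G e)
      else if i = len e then Orig (head G e)
      else Mid {(e, i), (arev e, len e - i)})"

text \<open>
  The subdivided graph. The arc \<open>(e, i)\<close> is the oriented edge from \<open>x\<^sup>e\<^sub>i\<close> to \<open>x\<^sup>e\<^bsub>i+1\<^esub>\<close>; its reverse
  is \<open>(arev e, len e - 1 - i)\<close>.
\<close>

definition subdiv ::
  "('v, 'e) pre_digraph \<Rightarrow> ('e \<Rightarrow> 'e) \<Rightarrow> ('e \<Rightarrow> nat) \<Rightarrow> (('v, 'e) subdiv_vert, 'e \<times> nat) pre_digraph" where
  "subdiv G arev len =
     \<lparr> verts = Orig ` verts G \<union> {subdiv_pt G arev len e i | e i. e \<in> arcs G \<and> 0 < i \<and> i < len e},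
       arcs = {(e, i). e \<in> arcs G \<and> i < len e},
       tail = (\<lambda>(e, i). subdiv_pt G arev len e i),
       head = (\<lambda>(e, i). subdiv_pt G arev len e (Suc i)) \<rparr>"

definition supp :: "('w \<Rightarrow> int) \<Rightarrow> 'w set" where
  "supp D = {w. D w \<noteq> 0}"

definition Div :: "('w, 'b) pre_digraph \<Rightarrow> ('w \<Rightarrow> int) set" where
  "Div H = {D. finite (supp D) \<and> supp D \<subseteq> verts H}"

text \<open>
  In a loopless bidirected graph the arcs with tail \<open>w\<close> correspond to the edges incident to \<open>w\<close>,
  the head being the other endpoint.
\<close>

definition principal_div :: "('w, 'b) pre_digraph \<Rightarrow> ('w \<Rightarrow> int) \<Rightarrow> 'w \<Rightarrow> int" where
  "principal_div H F w = (\<Sum>a \<in> out_arcs H w. F (head H a) - F w)"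

definition lin_equiv :: "('w, 'b) pre_digraph \<Rightarrow> ('w \<Rightarrow> int) \<Rightarrow> ('w \<Rightarrow> int) \<Rightarrow> bool" where
  "lin_equiv H D D' \<longleftrightarrow> D \<in> Div H \<and> D' \<in> Div H \<and> (\<exists>F. \<forall>w. D' w - D w = principal_div H F w)"

definition admissible ::
  "('v, 'e) pre_digraph \<Rightarrow> ('e \<Rightarrow> 'e) \<Rightarrow> ('e \<Rightarrow> nat) \<Rightarrow> (('v, 'e) subdiv_vert \<Rightarrow> int) \<Rightarrow> bool" where
  "admissible G arev len D \<longleftrightarrow>
     (\<forall>e \<in> arcs G.
        (\<forall>j \<in> {1..<len e}. D (subdiv_pt G arev len e j) = 0) \<or>
        (\<exists>j \<in> {1..<len e}. D (subdiv_pt G arev len e j) = 1 \<and>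
           (\<forall>i \<in> {1..<len e}. i \<noteq> j \<longrightarrow> D (subdiv_pt G arev len e i) = 0)))"

definition slope :: "('v, 'e) pre_digraph \<Rightarrow> ('e \<Rightarrow> nat) \<Rightarrow> ('v \<Rightarrow> int) \<Rightarrow> 'e \<Rightarrow> int" where
  "slope G len f e = \<lfloor>of_int (f (head G e) - f (tail G e)) / (of_nat (len e) :: rat)\<rfloor>"

definition edge_rem :: "('v, 'e) pre_digraph \<Rightarrow> ('e \<Rightarrow> nat) \<Rightarrow> ('v \<Rightarrow> int) \<Rightarrow> 'e \<Rightarrow> nat" where
  "edge_rem G len f e = nat ((f (head G e) - f (tail G e)) mod int (len e))"

definition div_len ::
  "('v, 'e) pre_digraph \<Rightarrow> ('e \<Rightarrow> 'e) \<Rightarrow> ('e \<Rightarrow> nat) \<Rightarrow> ('v \<Rightarrow> int) \<Rightarrow> ('v, 'e) subdiv_vert \<Rightarrow> int" where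
  "div_len G arev len f w =
     (case w of
        Orig u \<Rightarrow> (\<Sum>e \<in> out_arcs G u. slope G len f e)
      | Mid _ \<Rightarrow>
          (if \<exists>e \<in> arcs G. \<not> int (len e) dvd f (head G e) - f (tail G e) \<and>
                w = subdiv_pt G arev len (arev e) (edge_rem G len f e)
           then 1 else 0))"

locale length_graph = bidirected_digraph G arev + fin_digraph G + loopfree_digraph G
  for G :: "('v, 'e) pre_digraph" and arev :: "'e \<Rightarrow> 'e" +
  fixes len :: "'e \<Rightarrow> nat"
  assumes connected_graph: "connected G"
    and len_pos: "e \<in> arcs G \<Longrightarrow> 0 < len e"
    and len_rev: "e \<in> arcs G \<Longrightarrow> len (arev e) = len e"
begin

lemma subdiv_pt_rev:
  assumes "e \<in> arcs G" "i \<le> len e"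
  shows "subdiv_pt G arev len (arev e) (len e - i) = subdiv_pt G arev len e i"
  using assms len_pos[of e] len_rev[of e] by (auto simp: subdiv_pt_def)

lemma subdiv_pt_interior_eq_iff:
  assumes "e \<in> arcs G" "e' \<in> arcs G" "0 < i" "i < len e" "0 < j" "j < len e'"
  shows "subdiv_pt G arev len e i = subdiv_pt G arev len e' j \<longleftrightarrow>
    (e' = e \<and> j = i) \<or> (e' = arev e \<and> j = len e - i)"
  using assms len_rev[of e] len_rev[of e'] arev_neq[of e]
  by (auto simp: subdiv_pt_def doubleton_eq_iff)

lemma subdiv_pt_in_verts:
  assumes "e \<in> arcs G" "i \<le> len e"
  shows "subdiv_pt G arev len e i \<in> verts (subdiv G arev len)"
proof (cases "i = 0 \<or> i = len e")
  case True
  then show ?thesis using assms by (auto simp: subdiv_def subdiv_pt_def)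
next
  case False
  then show ?thesis using assms by (force simp: subdiv_def)
qed

lemma fin_digraph_subdiv: "fin_digraph (subdiv G arev len)"
proof
  show "tail (subdiv G arev len) a \<in> verts (subdiv G arev len)"
    if "a \<in> arcs (subdiv G arev len)" for a
    using that subdiv_pt_in_verts[of "fst a" "snd a"] by (auto simp: subdiv_def)
  show "head (subdiv G arev len) a \<in> verts (subdiv G arev len)"
    if "a \<in> arcs (subdiv G arev len)" for a
    using that subdiv_pt_in_verts[of "fst a" "Suc (snd a)"] by (auto simp: subdiv_def)
  have arcs: "arcs (subdiv G arev len) = Sigma (arcs G) (\<lambda>e. {..<len e})"
    by (auto simp: subdiv_def)
  show fin: "finite (arcs (subdiv G arev len))" by (simp add: arcs)
  have "verts (subdiv G arev len) \<subseteq>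
      Orig ` verts G \<union> (\<lambda>(e, i). subdiv_pt G arev len e i) ` arcs (subdiv G arev len)"
    by (force simp: subdiv_def)
  then show "finite (verts (subdiv G arev len))"
    using fin by (meson finite_UnI finite_imageI finite_subset finite_verts)
qed

lemma loopfree_subdiv: "loopfree_digraph (subdiv G arev len)"
proof -
  interpret S: fin_digraph "subdiv G arev len" by (rule fin_digraph_subdiv)
  show ?thesis
    by unfold_locales
       (auto simp: subdiv_def subdiv_pt_def doubleton_eq_iff no_loops arev_neq[symmetric]
             dest: arev_neq split: if_splits)
qed

lemma bidirected_subdiv:
  "bidirected_digraph (subdiv G arev len)
     (\<lambda>(e, i). if e \<in> arcs G \<and> i < len e then (arev e, len e - Suc i) else (e, i))"
proof -
  interpret S: fin_digraph "subdiv G arev len" by (rule fin_digraph_subdiv)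
  show ?thesis
  proof (rule S.bidirected_digraphI, goal_cases)
    case (4 a)
    then show ?case
      using subdiv_pt_rev[of "fst a" "Suc (snd a)"] by (auto simp: subdiv_def)
  qed (auto simp: subdiv_def len_rev arev_neq split: if_splits)
qed

end

end

theory Submission
  imports Defs
begin

text \<open>
  On the path replacing an edge \<open>e = uv\<close>, the divisor \<open>div F\<close> is the second difference of \<open>F\<close>.
  Hence \<open>div F\<close> is admissible iff along each such path \<open>F\<close> has slope \<open>a\<close> up to some point
  \<open>x\<^sub>j\<close>, \<open>1 \<le> j \<le> len e\<close>, and slope \<open>a + 1\<close> afterwards. Then
  \<open>F v - F u = a * len e + (len e - j)\<close> with \<open>0 \<le> len e - j < len e\<close>, so \<open>a\<close> and \<open>len e - j\<close> are
  quotient and remainder of \<open>F v - F u\<close> by \<open>len e\<close>, that is, \<open>div F\<close> is \<open>div_len\<close> of the restriction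
  of \<open>F\<close> to the original vertices. Conversely every \<open>f\<close> extends to such an \<open>F\<close>: on the path of \<open>e\<close>,
  take the maximum of the linear function starting at \<open>u\<close> with slope \<open>slope e\<close> and of the linear
  function starting at \<open>v\<close> with slope \<open>slope (arev e)\<close>.
\<close>

section \<open>Preliminaries on sequences, slopes and divisors\<close>

text \<open>The increments of \<open>h\<close> stay constant except for a jump by 1 at
  \<open>j\<close>; the formula sums them. If \<open>j = l\<close>, the jump never occurs and
  \<open>h\<close> is linear on the whole range.\<close>

lemma one_bend:
  fixes h :: "nat \<Rightarrow> int"
  assumes bend: "\<And>i. 0 < i \<Longrightarrow> i < l \<Longrightarrow>
      h (Suc i) - h i + (h (i - 1) - h i) = (if i = j then 1 else 0)"
    and "0 < j" "i \<le> l"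
  shows "h i = h 0 + (h 1 - h 0) * int i + max 0 (int i - int j)"
proof -
  have step: "h (Suc i) - h i = h 1 - h 0 + (if j \<le> i then 1 else 0)" if "i < l" for i
    using that
  proof (induction i)
    case 0
    then show ?case using \<open>0 < j\<close> by simp
  next
    case (Suc i)
    then show ?case using bend[of "Suc i"] by (auto split: if_splits)
  qed
  show ?thesis using \<open>i \<le> l\<close>
  proof (induction i)
    case 0
    then show ?case by simp
  next
    case (Suc i)
    then have "h (Suc i) = h 0 + (h 1 - h 0) * int i + max 0 (int i - int j)
        + (h 1 - h 0 + (if j \<le> i then 1 else 0))"
      using step[of i] by simp
    also have "\<dots> = h 0 + (h 1 - h 0) * int (Suc i) + max 0 (int (Suc i) - int j)"
      by (auto simp: distrib_left)
    finally show ?case .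
  qed
qed

lemma slope_eq_div: "slope G len f e = (f (head G e) - f (tail G e)) div int (len e)"
  unfolding slope_def by (metis floor_divide_of_int_eq of_int_of_nat_eq)

lemma principal_div_in_Div:
  assumes "fin_digraph H"
  shows "principal_div H F \<in> Div H"
proof -
  interpret fin_digraph H by fact
  have "supp (principal_div H F) \<subseteq> verts H"
  proof
    fix w assume "w \<in> supp (principal_div H F)"
    then have "out_arcs H w \<noteq> {}" by (auto simp: supp_def principal_div_def)
    then show "w \<in> verts H" by (auto simp: out_arcs_def)
  qed
  then show ?thesis using finite_subset[OF _ finite_verts] by (auto simp: Div_def)
qed

lemma Div_add:
  assumes "A \<in> Div H" "B \<in> Div H"
  shows "(\<lambda>w. A w + B w) \<in> Div H"
proof -
  have "supp (\<lambda>w. A w + B w) \<subseteq> supp A \<union> supp B" by (auto simp: supp_def)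
  moreover have "finite (supp A \<union> supp B)" "supp A \<union> supp B \<subseteq> verts H"
    using assms by (auto simp: Div_def)
  ultimately show ?thesis by (auto simp: Div_def intro: finite_subset)
qed

context length_graph
begin

section \<open>Admissibility and local structure of the subdivision\<close>

abbreviation "S \<equiv> subdiv G arev len"
abbreviation "x \<equiv> subdiv_pt G arev len"

text \<open>The position \<open>j = len e\<close> lies outside the interior and stands for an edge
  carrying no chip. Both cases of admissibility thus take the form of the bend condition in
  \<open>one_bend\<close>.\<close>

lemma admissible_iff:
  "admissible G arev len D \<longleftrightarrow>
    (\<forall>e \<in> arcs G. \<exists>j \<in> {1..len e}. \<forall>i \<in> {1..<len e}.
       D (x e i) = (if i = j then 1 else 0))"
  unfolding admissible_def
proof (intro ball_cong refl iffI)
  fix e assume e: "e \<in> arcs G"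
  let ?D = "\<lambda>i. D (x e i)"
  assume "(\<forall>j\<in>{1..<len e}. ?D j = 0) \<or>
    (\<exists>j\<in>{1..<len e}. ?D j = 1 \<and> (\<forall>i\<in>{1..<len e}. i \<noteq> j \<longrightarrow> ?D i = 0))"
  then show "\<exists>j\<in>{1..len e}. \<forall>i\<in>{1..<len e}. ?D i = (if i = j then 1 else 0)"
  proof
    assume "\<forall>j\<in>{1..<len e}. ?D j = 0"
    then show ?thesis using len_pos[OF e] by (intro bexI[of _ "len e"]) auto
  next
    assume "\<exists>j\<in>{1..<len e}. ?D j = 1 \<and> (\<forall>i\<in>{1..<len e}. i \<noteq> j \<longrightarrow> ?D i = 0)"
    then obtain j where "j \<in> {1..<len e}" "?D j = 1" "\<forall>i\<in>{1..<len e}. i \<noteq> j \<longrightarrow> ?D i = 0" by blast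
    then show ?thesis by (intro bexI[of _ j]) auto
  qed
next
  fix e assume e: "e \<in> arcs G"
  let ?D = "\<lambda>i. D (x e i)"
  assume "\<exists>j\<in>{1..len e}. \<forall>i\<in>{1..<len e}. ?D i = (if i = j then 1 else 0)"
  then obtain j where j: "j \<in> {1..len e}" "\<forall>i\<in>{1..<len e}. ?D i = (if i = j then 1 else 0)" by blast
  show "(\<forall>j\<in>{1..<len e}. ?D j = 0) \<or>
    (\<exists>j\<in>{1..<len e}. ?D j = 1 \<and> (\<forall>i\<in>{1..<len e}. i \<noteq> j \<longrightarrow> ?D i = 0))"
  proof (cases "j = len e")
    case True
    then show ?thesis using j by auto
  next
    case False
    then have "j \<in> {1..<len e}" using j by auto
    then show ?thesis using j(2) by (intro disjI2 bexI[of _ j]) auto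
  qed
qed

lemma subdiv_pt_0: "x e 0 = Orig (tail G e)"
  by (simp add: subdiv_pt_def)

lemma subdiv_pt_len: "e \<in> arcs G \<Longrightarrow> x e (len e) = Orig (head G e)"
  using len_pos[of e] by (simp add: subdiv_pt_def)

lemma subdiv_pt_interior: "0 < i \<Longrightarrow> i < len e \<Longrightarrow> x e i = Mid {(e, i), (arev e, len e - i)}"
  by (simp add: subdiv_pt_def)

lemma out_arcs_subdiv_Orig: "out_arcs S (Orig u) = (\<lambda>e. (e, 0)) ` out_arcs G u"
  using len_pos by (auto simp: subdiv_def out_arcs_def subdiv_pt_def split: if_splits)

text \<open>Each of the two names of an interior vertex starts exactly one arc, one in each
  direction along the path.\<close>

lemma out_arcs_subdiv_interior:
  assumes e: "e \<in> arcs G" and i: "0 < i" "i < len e"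
  shows "out_arcs S (x e i) = {(e, i), (arev e, len e - i)}"
proof -
  have tail0: "x e' 0 \<noteq> x e i" for e' using i by (simp add: subdiv_pt_def)
  have "x e' j = x e i \<longleftrightarrow> (e', j) \<in> {(e, i), (arev e, len e - i)}"
    if "e' \<in> arcs G" "j < len e'" for e' j
  proof (cases "j = 0")
    case True
    then show ?thesis using tail0[of e'] i by auto
  next
    case False
    then show ?thesis
      using subdiv_pt_interior_eq_iff[OF e that(1) i _ that(2)] by auto
  qed
  then show ?thesis
    using e i len_rev[OF e] by (auto simp: subdiv_def out_arcs_def)
qed

lemma principal_div_Orig:
  "principal_div S F (Orig u) = (\<Sum>e \<in> out_arcs G u. F (x e 1) - F (Orig u))"
  unfolding principal_div_def out_arcs_subdiv_Orig
  by (simp add: sum.reindex inj_on_def subdiv_def)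

lemma principal_div_interior:
  assumes e: "e \<in> arcs G" and i: "0 < i" "i < len e"
  shows "principal_div S F (x e i) =
    F (x e (Suc i)) - F (x e i) + (F (x e (i - 1)) - F (x e i))"
proof -
  have "x (arev e) (Suc (len e - i)) = x e (i - 1)"
    using subdiv_pt_rev[OF e, of "i - 1"] i by (simp add: Suc_diff_le)
  \<comment> \<open>Distinctness makes the sum over the outgoing arcs have two terms, even at the
    midpoint of an edge.\<close>
  moreover have "(e, i) \<noteq> (arev e, len e - i)" using arev_neq[OF e] by auto
  ultimately show ?thesis
    unfolding principal_div_def out_arcs_subdiv_interior[OF assms]
    by (simp add: subdiv_def)
qed

section \<open>Division with remainder along an edge\<close>

lemma edge_rem_less: "e \<in> arcs G \<Longrightarrow> edge_rem G len f e < len e"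
  using len_pos[of e] by (simp add: edge_rem_def nat_less_iff)

lemma int_edge_rem:
  "e \<in> arcs G \<Longrightarrow> int (edge_rem G len f e) = (f (head G e) - f (tail G e)) mod int (len e)"
  using len_pos[of e] by (simp add: edge_rem_def)

lemma edge_rem_eq_0_iff:
  "e \<in> arcs G \<Longrightarrow> edge_rem G len f e = 0 \<longleftrightarrow> int (len e) dvd f (head G e) - f (tail G e)"
  using int_edge_rem[of e f] by (metis dvd_eq_mod_eq_0 of_nat_eq_0_iff)

lemma head_eq_slope_rem:
  assumes "e \<in> arcs G"
  shows "f (head G e) = f (tail G e) + slope G len f e * int (len e) + int (edge_rem G len f e)"
  using div_mult_mod_eq[of "f (head G e) - f (tail G e)" "int (len e)"]
  by (simp add: slope_eq_div int_edge_rem[OF assms])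

lemma slope_rem_unique:
  assumes "e \<in> arcs G" "f (head G e) = f (tail G e) + a * int (len e) + int r" "r < len e"
  shows "slope G len f e = a" "edge_rem G len f e = r"
proof -
  have d: "f (head G e) - f (tail G e) = int r + a * int (len e)" using assms(2) by simp
  show "slope G len f e = a"
    unfolding slope_eq_div d using assms(3) by simp
  show "edge_rem G len f e = r"
    unfolding edge_rem_def d using assms(3) by simp
qed

text \<open>For \<open>0 < r < l\<close>, negating \<open>a * l + r\<close> gives
  \<open>(- a - 1) * l + (l - r)\<close>; for \<open>r = 0\<close> the sign just flips.\<close>

lemma slope_edge_rem_rev:
  assumes e: "e \<in> arcs G"
  shows "slope G len f (arev e) =
      (if edge_rem G len f e = 0 then - slope G len f e else - slope G len f e - 1)" (is ?s)
    and "edge_rem G len f (arev e) =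
      (if edge_rem G len f e = 0 then 0 else len e - edge_rem G len f e)" (is ?r)
proof -
  note h = head_eq_slope_rem[OF e, of f]
  have e': "arev e \<in> arcs G" using e by simp
  have "?s \<and> ?r"
  proof (cases "edge_rem G len f e = 0")
    case True
    then have "f (head G (arev e)) =
        f (tail G (arev e)) + (- slope G len f e) * int (len (arev e)) + int 0"
      using h e len_rev[OF e] by simp
    from slope_rem_unique[OF e' this] show ?thesis
      using True len_pos[OF e'] by simp
  next
    case False
    have "f (head G (arev e)) = f (tail G (arev e)) +
        (- slope G len f e - 1) * int (len (arev e)) + int (len e - edge_rem G len f e)"
      using h e len_rev[OF e] edge_rem_less[OF e, of f]
      by (simp add: of_nat_diff left_diff_distrib)
    from slope_rem_unique[OF e' this] show ?thesis
      using False len_rev[OF e] len_pos[OF e] by simp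
  qed
  then show ?s ?r by blast+
qed

text \<open>The chip of \<open>e\<close>, at distance \<open>edge_rem\<close> from the head, is at
  distance \<open>len e - edge_rem\<close> from the tail. Remainder 0 gives position
  \<open>len e\<close>, which no interior \<open>i\<close> attains.\<close>

lemma div_len_interior:
  assumes e: "e \<in> arcs G" and i: "0 < i" "i < len e"
  shows "div_len G arev len f (x e i) = (if i = len e - edge_rem G len f e then 1 else 0)"
proof -
  have "(\<exists>e' \<in> arcs G. \<not> int (len e') dvd f (head G e') - f (tail G e') \<and>
      x e i = x (arev e') (edge_rem G len f e')) \<longleftrightarrow> i = len e - edge_rem G len f e" (is "?L \<longleftrightarrow> ?R")
  proof
    assume ?L
    then obtain e' where e': "e' \<in> arcs G" "edge_rem G len f e' \<noteq> 0"
      and eq: "x e i = x (arev e') (edge_rem G len f e')"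
      using edge_rem_eq_0_iff by blast
    \<comment> \<open>The chip may come from either orientation of the edge; both give the same
      position, since nonzero remainders of opposite orientations add up to the length.\<close>
    have "(arev e' = e \<and> edge_rem G len f e' = i) \<or>
        (arev e' = arev e \<and> edge_rem G len f e' = len e - i)"
      using subdiv_pt_interior_eq_iff[OF e _ i, of "arev e'" "edge_rem G len f e'"]
        eq e' edge_rem_less[OF e'(1), of f] len_rev[OF e'(1)] by auto
    then show ?R
    proof (elim disjE conjE)
      assume "arev e' = e" "edge_rem G len f e' = i"
      then show ?R using slope_edge_rem_rev(2)[OF e'(1), of f] i len_rev[OF e'(1)] by auto
    next
      assume *: "arev e' = arev e" "edge_rem G len f e' = len e - i"
      then have "e' = e" by (metis arev_arev)
      then show ?R using * i by simp
    qed
  next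
    assume R: ?R
    then have "edge_rem G len f e \<noteq> 0" using i by auto
    moreover have "x (arev e) (edge_rem G len f e) = x e i"
      using subdiv_pt_rev[OF e, of i] i R by simp
    ultimately show ?L using e edge_rem_eq_0_iff[OF e, of f] by metis
  qed
  then show ?thesis using i by (simp add: div_len_def subdiv_pt_interior)
qed

text \<open>Divisors are compared as functions on the whole type, so values off the vertex set
  matter too.\<close>

lemma div_len_outside:
  assumes "w \<notin> verts S"
  shows "div_len G arev len f w = 0"
proof (cases w)
  case (Orig u)
  then have "out_arcs G u = {}" using assms by (auto simp: subdiv_def)
  then show ?thesis using Orig by (simp add: div_len_def)
next
  case (Mid s)
  have "x (arev e) (edge_rem G len f e) \<in> verts S" if "e \<in> arcs G" for e
    using subdiv_pt_in_verts[of "arev e" "edge_rem G len f e"] that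
      edge_rem_less[OF that, of f] len_rev[OF that] by auto
  then show ?thesis using Mid assms by (auto simp: div_len_def)
qed

lemma principal_div_outside: "w \<notin> verts S \<Longrightarrow> principal_div S F w = 0"
  using principal_div_in_Div[OF fin_digraph_subdiv, of F] by (auto simp: Div_def supp_def)

section \<open>Admissible principal divisors\<close>

lemma principal_div_eq_div_len:
  assumes "admissible G arev len (principal_div S F)"
  shows "principal_div S F = div_len G arev len (F \<circ> Orig)"
proof -
  define f where "f = F \<circ> Orig"
  have edge: "F (x e 1) - F (x e 0) = slope G len f e \<and>
      (\<forall>i \<in> {1..<len e}. principal_div S F (x e i) = (if i = len e - edge_rem G len f e then 1 else 0))"
    if e: "e \<in> arcs G" for e
  proof -
    obtain j where j: "j \<in> {1..len e}"
      and d: "\<And>i. i \<in> {1..<len e} \<Longrightarrow> principal_div S F (x e i) = (if i = j then 1 else 0)"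
      using assms e by (auto simp: admissible_iff)
    \<comment> \<open>At the far end of the path \<open>max\<close> equals \<open>len e - j\<close>,
      so the endpoint values determine the initial slope and the bend position by uniqueness of
      division with remainder.\<close>
    have "F (x e (len e)) = F (x e 0) + (F (x e 1) - F (x e 0)) * int (len e)
        + max 0 (int (len e) - int j)"
      using j d by (intro one_bend[where l = "len e"])
        (auto simp: principal_div_interior[OF e])
    then have "f (head G e) = f (tail G e) + (F (x e 1) - F (x e 0)) * int (len e) + int (len e - j)"
      using j by (simp add: f_def subdiv_pt_0 subdiv_pt_len[OF e] of_nat_diff)
    from slope_rem_unique[OF e this] j d show ?thesis by auto
  qed
  have "principal_div S F w = div_len G arev len f w" for w
  proof (cases "w \<in> verts S")
    case False
    then show ?thesis by (simp add: div_len_outside principal_div_outside)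
  next
    case True
    then consider u where "w = Orig u" | e i where "e \<in> arcs G" "0 < i" "i < len e" "w = x e i"
      by (auto simp: subdiv_def)
    then show ?thesis
    proof cases
      case 1
      have "F (x e 1) - F (Orig u) = slope G len f e" if "e \<in> out_arcs G u" for e
        using edge[of e] that by (auto simp: subdiv_pt_0)
      then show ?thesis using 1 by (simp add: principal_div_Orig div_len_def)
    next
      case 2
      then show ?thesis using edge[of e] by (simp add: div_len_interior)
    qed
  qed
  then show ?thesis unfolding f_def by blast
qed

section \<open>Extending functions from \<open>G\<close> to the subdivision\<close>

text \<open>An interior vertex carries its names from both orientations, so maximizing over its
  label needs no choice of orientation.\<close>

definition extension :: "('v \<Rightarrow> int) \<Rightarrow> ('v, 'e) subdiv_vert \<Rightarrow> int" where
  "extension f w = (case w of Orig u \<Rightarrow> f u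
     | Mid s \<Rightarrow> Max ((\<lambda>(e, i). f (tail G e) + slope G len f e * int i) ` s))"

text \<open>If the remainder is nonzero, the line from the head exceeds the line from the tail by
  \<open>i - (len e - edge_rem)\<close>; otherwise the two lines coincide.\<close>

lemma extension_subdiv_pt:
  assumes e: "e \<in> arcs G" and i: "i \<le> len e"
  shows "extension f (x e i) =
    f (tail G e) + slope G len f e * int i + max 0 (int i - int (len e - edge_rem G len f e))"
proof -
  note h = head_eq_slope_rem[OF e, of f] and r = edge_rem_less[OF e, of f]
  consider "i = 0" | "i = len e" | "0 < i" "i < len e" using i by linarith
  then show ?thesis
  proof cases
    case 1
    then show ?thesis by (simp add: subdiv_pt_0 extension_def)
  next
    case 2
    then show ?thesis using h r e by (simp add: subdiv_pt_len extension_def of_nat_diff)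
  next
    case 3
    have "extension f (x e i) = max (f (tail G e) + slope G len f e * int i)
        (f (head G e) + slope G len f (arev e) * int (len e - i))"
      using 3 e by (simp add: subdiv_pt_interior extension_def)
    then show ?thesis
      using 3 h r slope_edge_rem_rev(1)[OF e, of f]
      by (auto simp: of_nat_diff algebra_simps max_def)
  qed
qed

lemma admissible_extension: "admissible G arev len (principal_div S (extension f))"
  unfolding admissible_iff
proof
  fix e assume e: "e \<in> arcs G"
  let ?j = "len e - edge_rem G len f e"
  have "principal_div S (extension f) (x e i) = (if i = ?j then 1 else 0)"
    if i: "i \<in> {1..<len e}" for i
  proof -
    obtain k where k: "i = Suc k" using i by (cases i) auto
    \<comment> \<open>The linear part has second difference 0; that of the \<open>max\<close> term
      is the indicator of \<open>?j\<close>.\<close>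
    have "principal_div S (extension f) (x e i) = max 0 (int (Suc i) - int ?j)
        - 2 * max 0 (int i - int ?j) + max 0 (int k - int ?j)"
      using i k principal_div_interior[OF e, of i]
      by (simp add: extension_subdiv_pt[OF e] distrib_left)
    also have "\<dots> = (if i = ?j then 1 else 0)"
      unfolding k by (cases "?j \<le> k"; cases "?j = Suc k") simp_all
    finally show ?thesis .
  qed
  then show "\<exists>j\<in>{1..len e}. \<forall>i\<in>{1..<len e}.
      principal_div S (extension f) (x e i) = (if i = j then 1 else 0)"
    using edge_rem_less[OF e, of f] by (intro bexI[of _ ?j]) auto
qed

text \<open>No further computation is needed: an admissible principal divisor is determined by the
  restriction of its function to the original vertices, here \<open>f\<close>.\<close>

lemma principal_div_extension: "principal_div S (extension f) = div_len G arev len f"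
proof -
  have "extension f \<circ> Orig = f" by (auto simp: extension_def)
  then show ?thesis using principal_div_eq_div_len[OF admissible_extension, of f] by simp
qed

text \<open>Admissibility tests only interior vertices, so adding or subtracting a divisor supported
  on the original vertices preserves it.\<close>

lemma admissible_cong_interior:
  assumes "\<And>s. A (Mid s) = B (Mid s)"
  shows "admissible G arev len A \<longleftrightarrow> admissible G arev len B"
proof -
  have "A (x e i) = B (x e i)" if "i \<in> {1..<len e}" for e i
    using that assms by (simp add: subdiv_pt_interior)
  then show ?thesis by (simp add: admissible_def)
qed

end

theorem theorem2p4:
  fixes G :: "('v, 'e) pre_digraph" and arev :: "'e \<Rightarrow> 'e" and len :: "'e \<Rightarrow> nat"
    and D :: "('v, 'e) subdiv_vert \<Rightarrow> int"
  assumes "length_graph G arev len"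
    and "D \<in> Div (subdiv G arev len)"
    and "supp D \<subseteq> Orig ` verts G"
  shows "(\<forall>f :: 'v \<Rightarrow> int.
            admissible G arev len (\<lambda>w. D w + div_len G arev len f w) \<and>
            lin_equiv (subdiv G arev len) D (\<lambda>w. D w + div_len G arev len f w)) \<and>
         (\<forall>D' \<in> Div (subdiv G arev len).
            admissible G arev len D' \<and> lin_equiv (subdiv G arev len) D D' \<longrightarrow>
            (\<exists>f :: 'v \<Rightarrow> int. D' = (\<lambda>w. D w + div_len G arev len f w)))"
proof -
  interpret length_graph G arev len by fact
  have D0: "D (Mid s) = 0" for s using assms(3) by (auto simp: supp_def)
  show ?thesis
  proof (intro conjI allI ballI impI)
    fix f :: "'v \<Rightarrow> int"
    show "admissible G arev len (\<lambda>w. D w + div_len G arev len f w)"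
      using admissible_extension[of f]
      by (subst admissible_cong_interior[of _ "div_len G arev len f"])
        (simp_all add: D0 principal_div_extension)
    have "div_len G arev len f \<in> Div S"
      using principal_div_in_Div[OF fin_digraph_subdiv] principal_div_extension by metis
    then show "lin_equiv S D (\<lambda>w. D w + div_len G arev len f w)"
      using Div_add[OF assms(2)] assms(2) principal_div_extension[of f]
      by (auto simp: lin_equiv_def intro!: exI[of _ "extension f"])
  next
    fix D' assume D': "admissible G arev len D' \<and> lin_equiv S D D'"
    then obtain F where F: "\<And>w. D' w - D w = principal_div S F w" by (auto simp: lin_equiv_def)
    \<comment> \<open>\<open>D' - D\<close> agrees with \<open>D'\<close> at interior vertices,
      where \<open>D\<close> vanishes.\<close>
    have "admissible G arev len (principal_div S F)"
      using D' by (subst admissible_cong_interior[of _ D']) (simp_all add: F[symmetric] D0)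
    from principal_div_eq_div_len[OF this] have "D' = (\<lambda>w. D w + div_len G arev len (F \<circ> Orig) w)"
      using F by (auto simp: fun_eq_iff algebra_simps)
    then show "\<exists>f :: 'v \<Rightarrow> int. D' = (\<lambda>w. D w + div_len G arev len f w)" by blast
  qed
qed

end
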